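(* Let $n\ge1$, let $\Lambda\subset\mathbb{R}^n$ be an $n$-dimensional lattice whose dual satisfies $\Lambda^*\subseteq\mathbb{Z}^n$, let $\bar G^*$ be an $n\times n$ (integer) generator matrix of $\Lambda^*$ with Gram matrix $A^*$, and let $A=(A^* )^{-1}$ (the Gram matrix of $\Lambda$ with respect to the dual basis). Put $G^*=[\bar G^*\;\;0_{n\times1}]$, let $P$ be an $n\times(n+1)$ integer matrix, and for $w\in\mathbb{N}$ let $G_w^*=wG^*+P$, let $\Lambda_w^*$ be the lattice generated by the rows of $G_w^*$, $A_w^*=G_w^*G_w^{*t}$, $A_w=(A_w^* )^{-1}$, and $\Lambda_w=(\Lambda_w^* )^*$. Let $H_w$ be the $n\times n$ matrix of the last $n$ columns of $G_w^*$ and $Q_1=G^*P^t+PG^{*t}$. Assume (i) $\det(H_w)=\pm1$ for all $w\in\mathbb{N}$, and (ii) there exists $\alpha$ such that $Q_1=\alpha A^*$. Then each $\Lambda_w$ is the orthogonal projection of $\mathbb{Z}^{n+1}$ onto $\bm v_w^{\perp}$ for a vector $\bm v_w\in\mathbb{Z}^{n+1}$ whose infinity norm satisfies $$\|\bm v_w\|_\infty=\left|\sqrt{\det\Lambda^*}\,w^n+O(w^{n-1})\right|$$ for sufficiently large $w$, and there exist $c_w\in\mathbb{R}$ such that $$\|A-c_wA_w\|_\infty=O\!\left(\frac1{w^2}\right)=O\!\left(\frac{1}{\|\bm v_w\|_\infty^{2/n}}\right)\to0\quad\text{as } w\to\infty.$$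
   Context: $\det\Lambda^*$ denotes the determinant of a Gram matrix of $\Lambda^*$. For a matrix $M$, $\|M\|_\infty=\max_{i,j}|M_{ij}|$. The dual of a lattice $L$ is $\{x\in\mathrm{span}(L):\langle x,y\rangle\in\mathbb{Z}\ \forall y\in L\}$. *)

theory Defs
  imports
    "Jordan_Normal_Form.VS_Connect"
    "Jordan_Normal_Form.Gauss_Jordan_Elimination"
    "HOL-Library.Landau_Symbols"
begin

abbreviation real_span :: "nat \<Rightarrow> real vec set \<Rightarrow> real vec set" where
  "real_span m \<equiv> LinearCombinations.module.span class_ring (module_vec TYPE(real) m)"

abbreviation real_lin_indpt :: "nat \<Rightarrow> real vec set \<Rightarrow> bool" where
  "real_lin_indpt m S \<equiv> \<not> LinearCombinations.module.lin_dep class_ring (module_vec TYPE(real) m) S"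

definition lattice_of_rows :: "real mat \<Rightarrow> real vec set" where
  "lattice_of_rows B = vec_module.lattice_of (dim_col B) (rows B)"

(* Linear independence is a property of sets in the library, so repeated rows are
   excluded separately. *)
definition generator_matrix :: "nat \<Rightarrow> nat \<Rightarrow> real mat \<Rightarrow> real vec set \<Rightarrow> bool" where
  "generator_matrix k m B L \<longleftrightarrow>
     B \<in> carrier_mat k m \<and> distinct (rows B) \<and> real_lin_indpt m (set (rows B)) \<and>
     L = lattice_of_rows B"

(* k-dimensional lattice in R^m *)
definition is_lattice :: "nat \<Rightarrow> nat \<Rightarrow> real vec set \<Rightarrow> bool" where
  "is_lattice k m L \<longleftrightarrow> (\<exists>B. generator_matrix k m B L)"

definition dual_lattice :: "nat \<Rightarrow> real vec set \<Rightarrow> real vec set" where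
  "dual_lattice m L = {x \<in> real_span m L. \<forall>y\<in>L. x \<bullet> y \<in> \<int>}"

definition int_vecs :: "nat \<Rightarrow> real vec set" where
  "int_vecs m = {x \<in> carrier_vec m. \<forall>i<m. x $ i \<in> \<int>}"

definition gram_mat :: "real mat \<Rightarrow> real mat" where
  "gram_mat B = B * B\<^sup>T"

(* unspecified if M is singular *)
definition inv_mat :: "real mat \<Rightarrow> real mat" where
  "inv_mat M = the (mat_inverse M)"

definition append_zero_col :: "real mat \<Rightarrow> real mat" where
  "append_zero_col M =
     mat (dim_row M) (dim_col M + 1) (\<lambda>(i, j). if j < dim_col M then M $$ (i, j) else 0)"

definition drop_first_col :: "real mat \<Rightarrow> real mat" where
  "drop_first_col M = mat (dim_row M) (dim_col M - 1) (\<lambda>(i, j). M $$ (i, j + 1))"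

definition orth_proj :: "nat \<Rightarrow> real vec set \<Rightarrow> real vec \<Rightarrow> real vec" where
  "orth_proj m W x = (THE y. y \<in> W \<and> x - y \<in> vec_module.orthogonal_complement m W)"

definition vec_norm_inf :: "real vec \<Rightarrow> real" where
  "vec_norm_inf v = Max {\<bar>v $ i\<bar> | i. i < dim_vec v}"

definition mat_norm_inf :: "real mat \<Rightarrow> real" where
  "mat_norm_inf M = Max {\<bar>M $$ (i, j)\<bar> | i j. i < dim_row M \<and> j < dim_col M}"

end

theory Submission
  imports Defs "Jordan_Normal_Form.DL_Rank" "HOL-Real_Asymp.Real_Asymp"
begin

text \<open>
  Bordering \<open>G\<^sub>w\<close> by the row \<open>e\<^sub>0\<close> gives an integer matrix \<open>M\<^sub>w\<close> with determinant \<open>\<plusminus> det H\<^sub>w = \<plusminus> 1\<close>.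
  The cofactors \<open>v\<^sub>w\<close> of the new row satisfy \<open>M\<^sub>w v\<^sub>w = det M\<^sub>w e\<^sub>n\<close>, so the rows of \<open>G\<^sub>w\<close> span
  the hyperplane orthogonal to \<open>v\<^sub>w\<close>, and unimodularity of \<open>M\<^sub>w\<close> lifts every vector of that
  hyperplane having integral products with the rows of \<open>G\<^sub>w\<close> to an integer vector, modulo \<open>v\<^sub>w\<close>.
  As only the first \<open>n\<close> columns of \<open>G\<^sub>w\<close> grow with \<open>w\<close>, the last cofactor is
  \<open>det (Gbar) w\<^sup>n + O(w\<^sup>n\<^sup>-\<^sup>1)\<close> and all others are \<open>O(w\<^sup>n\<^sup>-\<^sup>1)\<close>.
  Finally, assumption (ii) gives \<open>A\<^sub>w\<^sup>* = c\<^sub>w A\<^sup>* + P P\<^sup>T\<close> with \<open>c\<^sub>w = w\<^sup>2 + \<alpha> w\<close>, so that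
  \<open>c\<^sub>w A\<^sub>w\<close> is the inverse of an \<open>O(w\<^sup>-\<^sup>2)\<close>-perturbation of \<open>A\<^sup>*\<close>.
\<close>

section \<open>Dual lattices and projection onto a hyperplane\<close>

text \<open>Lattice elements are integer combinations of the rows and every row lies in the lattice.
  Hence both the span and the integrality condition can be tested on the finitely many rows
  alone.\<close>

lemma dual_lattice_of_rows:
  assumes G: "G \<in> carrier_mat k m"
  shows "dual_lattice m (lattice_of_rows G) =
    {x \<in> real_span m (set (rows G)). \<forall>i<k. x \<bullet> row G i \<in> \<int>}"
proof -
  interpret vec_space "TYPE(real)" m .
  have rows: "set (rows G) \<subseteq> carrier_vec m"
    using G by (auto simp: rows_def)
  have L: "lattice_of_rows G = lattice_of (rows G)"
    using G by (simp add: lattice_of_rows_def)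
  have nth: "rows G ! i \<in> carrier_vec m" if "i < length (rows G)" for i
    using rows that nth_mem by blast
  have sub: "lattice_of (rows G) \<subseteq> span (set (rows G))"
  proof
    fix x assume "x \<in> lattice_of (rows G)"
    then obtain c where x: "x = sumlist (map (\<lambda>i. of_int (c i) \<cdot>\<^sub>v rows G ! i) [0..<length (rows G)])"
      by (rule in_latticeE)
    have "of_int (c i) \<cdot>\<^sub>v rows G ! i \<in> span (set (rows G))" if "i < length (rows G)" for i
      using that by (intro smult_in_span[OF rows] subsetD[OF in_own_span[OF rows]] nth_mem)
    then show "x \<in> span (set (rows G))"
      unfolding x by (intro sumlist_in_span[OF rows]) (clarsimp simp only: set_map set_upt atLeastLessThan_iff)
  qed
  have sup: "set (rows G) \<subseteq> lattice_of (rows G)"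
    using basis_in_latticeI[OF rows] by blast
  have sc: "lattice_of (rows G) \<subseteq> carrier_vec m"
    using sub span_is_subset2[OF rows] by blast
  have span: "span (lattice_of (rows G)) = span (set (rows G))"
    using span_subsetI[OF rows sub] span_is_monotone[OF sup] by blast
  have "(\<forall>y\<in>lattice_of (rows G). x \<bullet> y \<in> \<int>) \<longleftrightarrow> (\<forall>i<k. x \<bullet> row G i \<in> \<int>)"
    if x: "x \<in> carrier_vec m" for x
  proof safe
    fix i assume "\<forall>y\<in>lattice_of (rows G). x \<bullet> y \<in> \<int>" "i < k"
    moreover have "row G i \<in> set (rows G)"
      using \<open>i < k\<close> G by (auto simp: rows_def)
    ultimately show "x \<bullet> row G i \<in> \<int>"
      using sup by blast
  next
    fix y assume *: "\<forall>i<k. x \<bullet> row G i \<in> \<int>" and "y \<in> lattice_of (rows G)"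
    then obtain c where y: "y = sumlist (map (\<lambda>i. of_int (c i) \<cdot>\<^sub>v rows G ! i) [0..<length (rows G)])"
      by (auto elim: in_latticeE)
    have "x \<bullet> y = (\<Sum>z\<leftarrow>map (\<lambda>i. of_int (c i) \<cdot>\<^sub>v rows G ! i) [0..<length (rows G)]. x \<bullet> z)"
      unfolding y using nth x by (intro scalar_prod_right_sum_distrib) auto
    also have "\<dots> = (\<Sum>i\<leftarrow>[0..<length (rows G)]. of_int (c i) * (x \<bullet> row G i))"
      unfolding map_map o_def using nth x G
      by (intro arg_cong[where f = sum_list] map_cong refl) auto
    also have "\<dots> \<in> \<int>"
      using * G unfolding interv_sum_list_conv_sum_set_nat
      by (intro Ints_sum Ints_mult) auto
    finally show "x \<bullet> y \<in> \<int>" .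
  qed
  then show ?thesis
    unfolding dual_lattice_def L span
    using span_is_subset2[OF rows] by blast
qed

lemma scalar_prod_self_eq_0:
  fixes x :: "real vec"
  assumes "x \<in> carrier_vec m" "x \<bullet> x = 0"
  shows "x = 0\<^sub>v m"
  using assms conjugate_square_eq_0_vec[of x m] by simp

text \<open>Turns any splitting of \<open>x\<close> into a vector orthogonal to \<open>v\<close> and
  a multiple of \<open>v\<close> into a value of the definite description \<open>orth_proj\<close>.
  For uniqueness, the difference of two candidates lies in the hyperplane and is orthogonal to
  itself, hence zero.\<close>

lemma orth_proj_hyperplane:
  fixes v x :: "real vec"
  assumes v: "v \<in> carrier_vec m" "v \<noteq> 0\<^sub>v m" and x: "x \<in> carrier_vec m"
    and y: "y \<in> vec_module.orthogonal_complement m {v}" "x = y + t \<cdot>\<^sub>v v"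
  shows "orth_proj m (vec_module.orthogonal_complement m {v}) x = y"
proof -
  interpret vec_space "TYPE(real)" m .
  let ?W = "orthogonal_complement {v}"
  have yc: "y \<in> carrier_vec m" using y(1) by (simp add: orthogonal_complement_def)
  show ?thesis
    unfolding orth_proj_def
  proof (rule the_equality)
    have "x - y = t \<cdot>\<^sub>v v"
      using y(2) yc v by auto
    moreover have "v \<bullet> z = 0" if "z \<in> ?W" for z
      using that v comm_scalar_prod[of v m z] by (auto simp: orthogonal_complement_def)
    ultimately show "y \<in> ?W \<and> x - y \<in> orthogonal_complement ?W"
      using y(1) v by (auto simp: orthogonal_complement_def)
  next
    fix z assume z: "z \<in> ?W \<and> x - z \<in> orthogonal_complement ?W"
    then have zc: "z \<in> carrier_vec m" and zv: "z \<bullet> v = 0"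
      by (auto simp: orthogonal_complement_def)
    have d: "y - z \<in> ?W"
      using y(1) yc zc zv v by (auto simp: orthogonal_complement_def minus_scalar_prod_distrib[of _ m])
    have "v \<bullet> (y - z) = 0"
      using d v yc zc comm_scalar_prod[of v m "y - z"] by (auto simp: orthogonal_complement_def)
    moreover have "(x - z) \<bullet> (y - z) = 0"
      using z d by (auto simp: orthogonal_complement_def)
    moreover have "x - z = (y - z) + t \<cdot>\<^sub>v v"
      using y(2) yc zc v by auto
    ultimately have "(y - z) \<bullet> (y - z) = 0"
      using yc zc v by (simp add: add_scalar_prod_distrib[of _ m])
    then have e: "y - z = 0\<^sub>v m"
      by (rule scalar_prod_self_eq_0[rotated]) (use yc zc in auto)
    show "z = y"
    proof (rule eq_vecI)
      fix i assume "i < dim_vec y"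
      then have "(y - z) $ i = 0" using e yc by simp
      then show "z $ i = y $ i" using \<open>i < dim_vec y\<close> yc zc by simp
    qed (use yc zc in auto)
  qed
qed

section \<open>Integrality of determinants and adjugates\<close>

lemma det_Ints:
  fixes M :: "real mat"
  assumes "M \<in> carrier_mat n n" "\<And>i j. i < n \<Longrightarrow> j < n \<Longrightarrow> M $$ (i, j) \<in> \<int>"
  shows "det M \<in> \<int>"
proof -
  have "p i < n" if "p permutes {0..<n}" "i < n" for p i
    using permutes_in_image[OF that(1), of i] that by simp
  then show ?thesis
    unfolding det_def'[OF assms(1)]
    by (intro Ints_sum Ints_mult Ints_prod assms(2)) (auto simp: sign_def)
qed

text \<open>Each entry is a signed minor, hence an integer. This makes the inverse integral once the
  determinant is \<open>1\<close> or \<open>-1\<close>.\<close>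

lemma adj_mat_Ints:
  fixes M :: "real mat"
  assumes "M \<in> carrier_mat n n" "\<And>i j. i < n \<Longrightarrow> j < n \<Longrightarrow> M $$ (i, j) \<in> \<int>"
    and "i < n" "j < n"
  shows "adj_mat M $$ (i, j) \<in> \<int>"
proof -
  have "det (mat_delete M j i) \<in> \<int>"
    by (rule det_Ints[where n = "n - 1"]) (use assms in \<open>auto simp: mat_delete_def\<close>)
  then show ?thesis
    using assms by (simp add: adj_mat_def cofactor_def)
qed

section \<open>The bordered matrix and the normal vector\<close>

text \<open>The border is the unit vector at index \<open>0\<close> because Laplace expansion along
  it deletes the first column, which relates the determinant to
  \<open>drop_first_col G\<close>.\<close>

definition append_unit_row :: "real mat \<Rightarrow> real mat" where
  "append_unit_row G = mat (dim_row G + 1) (dim_col G)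
     (\<lambda>(i, j). if i < dim_row G then G $$ (i, j) else if j = 0 then 1 else 0)"

text \<open>The generalised cross product of the rows of \<open>G\<close>: its signed maximal
  minors, obtained as the cofactors of the border row.\<close>

definition normal_vec :: "real mat \<Rightarrow> real vec" where
  "normal_vec G = col (adj_mat (append_unit_row G)) (dim_row G)"

context
  fixes n :: nat and G :: "real mat"
  assumes G: "G \<in> carrier_mat n (Suc n)"
begin

lemma append_unit_row_carrier: "append_unit_row G \<in> carrier_mat (Suc n) (Suc n)"
  using G by (simp add: append_unit_row_def)

lemma normal_vec_carrier: "normal_vec G \<in> carrier_vec (Suc n)"
  using carrier_matD[OF adj_mat(1)[OF append_unit_row_carrier]]
  by (intro carrier_vecI) (simp add: normal_vec_def)

lemma normal_vec_nth:
  "j \<le> n \<Longrightarrow> normal_vec G $ j = (-1) ^ (n + j) * det (mat_delete (append_unit_row G) n j)"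
  using G append_unit_row_carrier by (simp add: normal_vec_def adj_mat_def cofactor_def)

lemma row_append_unit_row: "i < n \<Longrightarrow> row (append_unit_row G) i = row G i"
  using G by (intro eq_vecI) (auto simp: append_unit_row_def)

lemma det_append_unit_row:
  "det (append_unit_row G) = (-1) ^ n * det (drop_first_col G)"
proof -
  have "det (append_unit_row G) =
      (\<Sum>j<Suc n. append_unit_row G $$ (n, j) * cofactor (append_unit_row G) n j)"
    by (rule laplace_expansion_row[OF append_unit_row_carrier]) simp
  also have "\<dots> = (\<Sum>j<Suc n. if j = 0 then cofactor (append_unit_row G) n j else 0)"
    using G by (intro sum.cong refl) (auto simp: append_unit_row_def)
  also have "\<dots> = cofactor (append_unit_row G) n 0"
    by (simp add: sum.delta)
  also have "mat_delete (append_unit_row G) n 0 = drop_first_col G"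
    using G by (intro eq_matI) (auto simp: mat_delete_def append_unit_row_def drop_first_col_def)
  ultimately show ?thesis
    by (simp add: cofactor_def)
qed

text \<open>This is column \<open>n\<close> of the identity
  \<open>M * adj_mat M = det M * 1\<close>. The entries below \<open>n\<close> yield orthogonality
  to the rows of \<open>G\<close>; the last entry, where the border row picks out coordinate
  \<open>0\<close>, yields \<open>normal_vec_0\<close>.\<close>

lemma append_unit_row_mult_normal_vec:
  "append_unit_row G *\<^sub>v normal_vec G = det (append_unit_row G) \<cdot>\<^sub>v unit_vec (Suc n) n"
proof -
  have "append_unit_row G *\<^sub>v normal_vec G = col (append_unit_row G * adj_mat (append_unit_row G)) n"
    unfolding normal_vec_def using G
    by (subst col_mult2[OF append_unit_row_carrier adj_mat(1)[OF append_unit_row_carrier]]) auto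
  then show ?thesis
    by (simp add: adj_mat(2)[OF append_unit_row_carrier])
qed

lemma row_scalar_prod_normal_vec:
  assumes "i < n"
  shows "row G i \<bullet> normal_vec G = 0"
  using arg_cong[OF append_unit_row_mult_normal_vec, of "\<lambda>x. x $ i"] assms
    append_unit_row_carrier row_append_unit_row[OF assms]
  by (simp add: index_unit_vec)

lemma normal_vec_0: "normal_vec G $ 0 = det (append_unit_row G)"
proof -
  have "row (append_unit_row G) n = unit_vec (Suc n) 0"
    using G by (intro eq_vecI) (auto simp: append_unit_row_def)
  then show ?thesis
    using arg_cong[OF append_unit_row_mult_normal_vec, of "\<lambda>x. x $ n"]
      append_unit_row_carrier normal_vec_carrier
    by simp
qed

text \<open>The rows are orthogonal to the normal vector, which gives one inclusion. Conversely,
  \<open>x\<close> is expanded in the rows of the invertible bordered matrix; pairing the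
  coefficient vector with \<open>M v = det M * e_n\<close> shows that \<open>x\<close> orthogonal to
  \<open>v\<close> needs no multiple of the border row.\<close>

lemma span_rows_eq_normal_hyperplane:
  assumes d: "det (append_unit_row G) \<noteq> 0"
  shows "real_span (Suc n) (set (rows G)) = vec_module.orthogonal_complement (Suc n) {normal_vec G}"
proof -
  interpret vec_space "TYPE(real)" "Suc n" .
  let ?M = "append_unit_row G" and ?v = "normal_vec G"
  note M = append_unit_row_carrier and v = normal_vec_carrier
  have rs: "span (set (rows G)) = {x \<in> carrier_vec (Suc n). \<exists>y\<in>carrier_vec n. G\<^sup>T *\<^sub>v y = x}"
    using row_space_eq[OF G] G by (simp add: row_space_def)
  have Gv: "G *\<^sub>v ?v = 0\<^sub>v n"
    using G row_scalar_prod_normal_vec by (intro eq_vecI) auto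
  show ?thesis
  proof (intro subset_antisym subsetI)
    fix x assume "x \<in> span (set (rows G))"
    then obtain y where y: "y \<in> carrier_vec n" "x = G\<^sup>T *\<^sub>v y" "x \<in> carrier_vec (Suc n)"
      unfolding rs by blast
    have "x \<bullet> ?v = y \<bullet> (G *\<^sub>v ?v)"
      unfolding y(2) by (rule transpose_vec_mult_scalar[OF G v y(1)])
    then show "x \<in> orthogonal_complement {?v}"
      using y Gv by (simp add: orthogonal_complement_def)
  next
    fix x assume "x \<in> orthogonal_complement {?v}"
    then have x: "x \<in> carrier_vec (Suc n)" and xv: "x \<bullet> ?v = 0"
      by (auto simp: orthogonal_complement_def)
    \<comment> \<open>The inverse transpose of \<open>?M\<close> applied to \<open>x\<close>, that
      is, the coefficients of \<open>x\<close> in the rows of \<open>?M\<close>.\<close>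
    define c where "c = (1 / det ?M) \<cdot>\<^sub>v ((adj_mat ?M)\<^sup>T *\<^sub>v x)"
    have adjT: "(adj_mat ?M)\<^sup>T \<in> carrier_mat (Suc n) (Suc n)"
      using adj_mat(1)[OF M] by simp
    have c: "c \<in> carrier_vec (Suc n)"
      using adjT x by (auto simp: c_def)
    have "?M\<^sup>T *\<^sub>v c = (1 / det ?M) \<cdot>\<^sub>v (?M\<^sup>T *\<^sub>v ((adj_mat ?M)\<^sup>T *\<^sub>v x))"
      unfolding c_def using M adjT x by (intro mult_mat_vec) auto
    also have "?M\<^sup>T *\<^sub>v ((adj_mat ?M)\<^sup>T *\<^sub>v x) = (?M\<^sup>T * (adj_mat ?M)\<^sup>T) *\<^sub>v x"
      using M adjT x by (intro assoc_mult_mat_vec[symmetric]) auto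
    also have "?M\<^sup>T * (adj_mat ?M)\<^sup>T = (adj_mat ?M * ?M)\<^sup>T"
      using transpose_mult[OF adj_mat(1)[OF M] M] by simp
    also have "\<dots> *\<^sub>v x = det ?M \<cdot>\<^sub>v x"
      unfolding adj_mat(3)[OF M] using x by (intro eq_vecI) auto
    finally have Mc: "?M\<^sup>T *\<^sub>v c = x"
      using d x by (simp add: smult_smult_assoc)
    have "0 = c \<bullet> (?M *\<^sub>v ?v)"
      using transpose_vec_mult_scalar[OF M v c] Mc xv by simp
    also have "\<dots> = det ?M * c $ n"
      unfolding append_unit_row_mult_normal_vec using c by simp
    finally have cn: "c $ n = 0"
      using d by simp
    have "G\<^sup>T *\<^sub>v vec n (\<lambda>i. c $ i) = ?M\<^sup>T *\<^sub>v c"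
    proof (rule eq_vecI)
      fix j assume "j < dim_vec (?M\<^sup>T *\<^sub>v c)"
      then have j: "j < Suc n" using M by simp
      have "(?M\<^sup>T *\<^sub>v c) $ j = (\<Sum>i<Suc n. ?M $$ (i, j) * c $ i)"
        using j M c by (simp add: scalar_prod_def lessThan_atLeast0)
      also have "\<dots> = (\<Sum>i<n. G $$ (i, j) * c $ i)"
        using j G cn by (simp add: append_unit_row_def)
      also have "\<dots> = (G\<^sup>T *\<^sub>v vec n (\<lambda>i. c $ i)) $ j"
        using j G by (simp add: scalar_prod_def lessThan_atLeast0)
      finally show "(G\<^sup>T *\<^sub>v vec n (\<lambda>i. c $ i)) $ j = (?M\<^sup>T *\<^sub>v c) $ j" ..
    qed (use G M in auto)
    then show "x \<in> span (set (rows G))"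
      unfolding rs Mc using x by auto
  qed
qed

text \<open>Given \<open>x\<close> in the dual, an integer \<open>z\<close> with the same products
  with the rows of \<open>G\<close> is found by solving a unimodular system; \<open>x\<close> and
  \<open>z\<close> then differ by a multiple of the normal vector, so \<open>z\<close> projects to
  \<open>x\<close>. Conversely, projecting an integer vector leaves its products with the rows
  unchanged, and these are integers.\<close>

lemma dual_lattice_of_rows_eq_projection:
  assumes Z: "\<And>i j. i < n \<Longrightarrow> j < Suc n \<Longrightarrow> G $$ (i, j) \<in> \<int>"
    and d: "det (append_unit_row G) = 1 \<or> det (append_unit_row G) = -1"
  shows "dual_lattice (Suc n) (lattice_of_rows G) =
    orth_proj (Suc n) (vec_module.orthogonal_complement (Suc n) {normal_vec G}) ` int_vecs (Suc n)"
    (is "?L = orth_proj _ ?W ` _")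
proof -
  interpret vec_space "TYPE(real)" "Suc n" .
  let ?M = "append_unit_row G" and ?v = "normal_vec G"
  note M = append_unit_row_carrier and v = normal_vec_carrier
  have d0: "det ?M \<noteq> 0" and dZ: "det ?M \<in> \<int>" and dd: "det ?M * det ?M = 1"
    using d by auto
  have v0: "?v \<noteq> 0\<^sub>v (Suc n)"
    using normal_vec_0 d0 by auto
  have MZ: "?M $$ (i, j) \<in> \<int>" if "i < Suc n" "j < Suc n" for i j
    using that G Z by (auto simp: append_unit_row_def)
  have L: "?L = {x \<in> ?W. \<forall>i<n. x \<bullet> row G i \<in> \<int>}"
    using dual_lattice_of_rows[OF G] span_rows_eq_normal_hyperplane[OF d0] by simp
  show ?thesis
    unfolding L
  proof (intro subset_antisym subsetI)
    fix x assume "x \<in> {x \<in> ?W. \<forall>i<n. x \<bullet> row G i \<in> \<int>}"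
    then have xW: "x \<in> ?W" and x: "x \<in> carrier_vec (Suc n)" and xG: "\<And>i. i < n \<Longrightarrow> x \<bullet> row G i \<in> \<int>"
      by (auto simp: orthogonal_complement_def)
    \<comment> \<open>The product with the border row may be prescribed freely as an integer;
      \<open>0\<close> is taken.\<close>
    define b where "b = vec (Suc n) (\<lambda>i. if i < n then x \<bullet> row G i else 0)"
    define s where "s = row ?M n \<bullet> x"
    \<comment> \<open>Since \<open>det ?M\<close> is its own inverse, \<open>z\<close> is the
      solution of \<open>?M *\<^sub>v z = b\<close>.\<close>
    define z where "z = det ?M \<cdot>\<^sub>v (adj_mat ?M *\<^sub>v b)"
    have adj: "adj_mat ?M \<in> carrier_mat (Suc n) (Suc n)" using adj_mat(1)[OF M] .
    have bc: "b \<in> carrier_vec (Suc n)" by (simp add: b_def)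
    have z: "z \<in> int_vecs (Suc n)"
      unfolding int_vecs_def
    proof (intro CollectI conjI allI impI)
      show "z \<in> carrier_vec (Suc n)" using adj bc by (auto simp: z_def)
      fix i assume i: "i < Suc n"
      have "z $ i = det ?M * (\<Sum>j<Suc n. adj_mat ?M $$ (i, j) * b $ j)"
        using i adj bc by (simp add: z_def scalar_prod_def lessThan_atLeast0)
      also have "\<dots> \<in> \<int>"
        using i xG by (intro Ints_mult Ints_sum dZ adj_mat_Ints[OF M MZ]) (auto simp: b_def)
      finally show "z $ i \<in> \<int>" .
    qed
    \<comment> \<open>\<open>x\<close> meets the system except in the border coordinate, and the
      adjugate sends that unit vector to \<open>?v\<close>. So the defect is a multiple of
      \<open>?v\<close>.\<close>
    have "?M *\<^sub>v x = b + s \<cdot>\<^sub>v unit_vec (Suc n) n"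
    proof (rule eq_vecI)
      fix i assume "i < dim_vec (b + s \<cdot>\<^sub>v unit_vec (Suc n) n)"
      then have "i < Suc n" by simp
      then show "(?M *\<^sub>v x) $ i = (b + s \<cdot>\<^sub>v unit_vec (Suc n) n) $ i"
        using M x row_append_unit_row[of i] comm_scalar_prod[of x "Suc n" "row G i"] G
        by (cases "i < n") (auto simp: b_def s_def less_Suc_eq)
    qed (use M in simp)
    then have Mx: "adj_mat ?M *\<^sub>v (?M *\<^sub>v x) =
        adj_mat ?M *\<^sub>v b + s \<cdot>\<^sub>v (adj_mat ?M *\<^sub>v unit_vec (Suc n) n)"
      using adj bc by (simp add: mult_add_distrib_mat_vec[of _ "Suc n" "Suc n"] mult_mat_vec[of _ "Suc n" "Suc n"])
    have "adj_mat ?M *\<^sub>v (?M *\<^sub>v x) = (adj_mat ?M * ?M) *\<^sub>v x"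
      using adj M x by simp
    also have "\<dots> = det ?M \<cdot>\<^sub>v x"
      unfolding adj_mat(3)[OF M] using x by (intro eq_vecI) auto
    moreover have "adj_mat ?M *\<^sub>v unit_vec (Suc n) n = ?v"
      using adj G by (intro eq_vecI) (auto simp: normal_vec_def)
    ultimately have "det ?M \<cdot>\<^sub>v x = adj_mat ?M *\<^sub>v b + s \<cdot>\<^sub>v ?v"
      using Mx by simp
    then have "det ?M \<cdot>\<^sub>v (det ?M \<cdot>\<^sub>v x) = det ?M \<cdot>\<^sub>v (adj_mat ?M *\<^sub>v b + s \<cdot>\<^sub>v ?v)"
      by simp
    then have "x = z + (det ?M * s) \<cdot>\<^sub>v ?v"
      using x adj bc v
      by (simp add: z_def smult_smult_assoc dd smult_add_distrib_vec[of _ "Suc n"])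
    moreover have "z \<in> carrier_vec (Suc n)" using z by (simp add: int_vecs_def)
    ultimately have zx: "z = x + (- (det ?M * s)) \<cdot>\<^sub>v ?v"
      using v by (intro eq_vecI) auto
    show "x \<in> orth_proj (Suc n) ?W ` int_vecs (Suc n)"
      using orth_proj_hyperplane[OF v v0 \<open>z \<in> carrier_vec (Suc n)\<close> xW zx] z by force
  next
    fix y assume "y \<in> orth_proj (Suc n) ?W ` int_vecs (Suc n)"
    then obtain z where z: "z \<in> int_vecs (Suc n)" and y: "y = orth_proj (Suc n) ?W z"
      by blast
    have zc: "z \<in> carrier_vec (Suc n)" using z by (simp add: int_vecs_def)
    define t where "t = (z \<bullet> ?v) / (?v \<bullet> ?v)"
    define x where "x = z - t \<cdot>\<^sub>v ?v"
    have xc: "x \<in> carrier_vec (Suc n)" using zc v by (auto simp: x_def)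
    have "?v \<bullet> ?v \<noteq> 0" using scalar_prod_self_eq_0[OF v] v0 by blast
    then have "x \<bullet> ?v = 0"
      using zc v by (simp add: x_def t_def minus_scalar_prod_distrib[of _ "Suc n"])
    then have xW: "x \<in> ?W"
      using xc by (simp add: orthogonal_complement_def)
    have zx: "z = x + t \<cdot>\<^sub>v ?v"
      using zc v by (auto simp: x_def)
    have "y = x"
      unfolding y by (rule orth_proj_hyperplane[OF v v0 zc xW zx])
    moreover have "x \<bullet> row G i \<in> \<int>" if i: "i < n" for i
    proof -
      have r: "row G i \<in> carrier_vec (Suc n)" using G i by auto
      have "x \<bullet> row G i = z \<bullet> row G i"
        using zc v r row_scalar_prod_normal_vec[OF i] comm_scalar_prod[OF v r]
        by (simp add: x_def minus_scalar_prod_distrib[of _ "Suc n"])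
      also have "\<dots> = (\<Sum>j<Suc n. z $ j * G $$ (i, j))"
        using i G zc by (simp add: scalar_prod_def lessThan_atLeast0)
      also have "\<dots> \<in> \<int>"
        using z i Z by (intro Ints_sum Ints_mult) (auto simp: int_vecs_def)
      finally show ?thesis .
    qed
    ultimately show "y \<in> {x \<in> ?W. \<forall>i<n. x \<bullet> row G i \<in> \<int>}"
      using xW by simp
  qed
qed

lemma normal_vec_int:
  assumes Z: "\<And>i j. i < n \<Longrightarrow> j < Suc n \<Longrightarrow> G $$ (i, j) \<in> \<int>"
  shows "normal_vec G \<in> int_vecs (Suc n)"
proof -
  note M = append_unit_row_carrier
  have MZ: "append_unit_row G $$ (i, j) \<in> \<int>" if "i < Suc n" "j < Suc n" for i j
    using that G Z by (auto simp: append_unit_row_def)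
  show ?thesis
    using normal_vec_carrier adj_mat_Ints[OF M MZ, of _ n] carrier_matD[OF adj_mat(1)[OF M]] G
    by (auto simp: int_vecs_def normal_vec_def)
qed

text \<open>A kernel vector \<open>y\<close> of the Gram matrix makes the squared length of
  \<open>G\<^sup>T *\<^sub>v y\<close> vanish. Padding \<open>y\<close> by a zero coefficient for
  the border row then gives a kernel vector of the transposed bordered matrix. This ensures that
  \<open>inv_mat\<close> of the Gram matrix is a genuine inverse.\<close>

lemma det_gram_mat_nonzero:
  assumes d: "det (append_unit_row G) \<noteq> 0"
  shows "det (gram_mat G) \<noteq> 0"
proof
  let ?M = "append_unit_row G"
  note M = append_unit_row_carrier
  have gram: "gram_mat G \<in> carrier_mat n n" using G by (simp add: gram_mat_def)
  assume "det (gram_mat G) = 0"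
  then obtain y where y: "y \<in> carrier_vec n" "y \<noteq> 0\<^sub>v n" "gram_mat G *\<^sub>v y = 0\<^sub>v n"
    using det_0_iff_vec_prod_zero[OF gram] by blast
  have GT: "G\<^sup>T *\<^sub>v y \<in> carrier_vec (Suc n)" using G y by auto
  have "(G\<^sup>T *\<^sub>v y) \<bullet> (G\<^sup>T *\<^sub>v y) = y \<bullet> (G *\<^sub>v (G\<^sup>T *\<^sub>v y))"
    by (rule transpose_vec_mult_scalar[OF G GT y(1)])
  also have "G *\<^sub>v (G\<^sup>T *\<^sub>v y) = gram_mat G *\<^sub>v y"
    unfolding gram_mat_def using G y by (intro assoc_mult_mat_vec[symmetric]) auto
  finally have "(G\<^sup>T *\<^sub>v y) \<bullet> (G\<^sup>T *\<^sub>v y) = 0"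
    using y by simp
  then have GTy: "G\<^sup>T *\<^sub>v y = 0\<^sub>v (Suc n)"
    by (rule scalar_prod_self_eq_0[OF GT])
  define c where "c = vec (Suc n) (\<lambda>i. if i < n then y $ i else 0)"
  have c: "c \<in> carrier_vec (Suc n)" by (simp add: c_def)
  have "?M\<^sup>T *\<^sub>v c = G\<^sup>T *\<^sub>v y"
  proof (rule eq_vecI)
    fix j assume "j < dim_vec (G\<^sup>T *\<^sub>v y)"
    then have j: "j < Suc n" using G by simp
    have "(?M\<^sup>T *\<^sub>v c) $ j = (\<Sum>i<Suc n. ?M $$ (i, j) * c $ i)"
      using j M c by (simp add: scalar_prod_def lessThan_atLeast0)
    also have "\<dots> = (\<Sum>i<n. G $$ (i, j) * y $ i)"
      using j G by (simp add: append_unit_row_def c_def)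
    also have "\<dots> = (G\<^sup>T *\<^sub>v y) $ j"
      using j G y by (simp add: scalar_prod_def lessThan_atLeast0)
    finally show "(?M\<^sup>T *\<^sub>v c) $ j = (G\<^sup>T *\<^sub>v y) $ j" .
  qed (use G M in auto)
  moreover have "c \<noteq> 0\<^sub>v (Suc n)"
  proof
    assume "c = 0\<^sub>v (Suc n)"
    then have "c $ i = 0" if "i < n" for i
      using that by simp
    then have "y $ i = 0" if "i < n" for i
      using that by (fastforce simp: c_def)
    then show False using y by auto
  qed
  ultimately have "det (?M\<^sup>T) = 0"
    using det_0_iff_vec_prod_zero[of "?M\<^sup>T" "Suc n"] M c GTy by auto
  then show False
    using d det_transpose[OF M] by simp
qed

end

section \<open>Determinants of affine matrix families\<close>

text \<open>Only the leading coefficient of a product of affine functions is tracked. Splitting off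
  the last factor expresses the new error through the previous one plus a term of order
  \<open>w ^ m\<close>.\<close>

lemma prod_affine_bigo:
  fixes x y :: "nat \<Rightarrow> real"
  shows "(\<lambda>w. (\<Prod>i<m. real w * x i + y i) - real w ^ m * (\<Prod>i<m. x i)) \<in> O(\<lambda>w. real w ^ (m - 1))"
proof (induction m)
  case 0
  then show ?case by simp
next
  case (Suc m)
  let ?D = "\<lambda>w. (\<Prod>i<m. real w * x i + y i) - real w ^ m * (\<Prod>i<m. x i)"
  have eq: "(\<lambda>w. (\<Prod>i<Suc m. real w * x i + y i) - real w ^ Suc m * (\<Prod>i<Suc m. x i)) =
      (\<lambda>w. (real w * x m + y m) * ?D w + (y m * (\<Prod>i<m. x i)) * real w ^ m)"
    by (rule ext) (simp add: algebra_simps)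
  have 1: "(\<lambda>w. (real w * x m + y m) * ?D w) \<in> O(\<lambda>w. real w ^ m)"
  \<comment> \<open>For \<open>m = 0\<close> the error \<open>?D\<close> is identically zero. This
    must be separated because the exponent \<open>m - 1\<close> is truncated and multiplying by
    \<open>w\<close> would not give \<open>w ^ 0\<close>.\<close>
  proof (cases m)
    case (Suc k)
    have "\<forall>\<^sub>F w in sequentially. norm (real w * x m + y m) \<le> (\<bar>x m\<bar> + \<bar>y m\<bar>) * norm (real w)"
    proof (rule eventually_sequentiallyI[of 1])
      fix w :: nat assume "w \<ge> 1"
      then have "\<bar>y m\<bar> * 1 \<le> \<bar>y m\<bar> * real w"
        by (intro mult_left_mono) auto
      then show "norm (real w * x m + y m) \<le> (\<bar>x m\<bar> + \<bar>y m\<bar>) * norm (real w)"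
        using abs_triangle_ineq[of "real w * x m" "y m"] by (simp add: abs_mult algebra_simps)
    qed
    then have "(\<lambda>w. real w * x m + y m) \<in> O(\<lambda>w. real w)"
      by (rule bigoI)
    from landau_o.big.mult[OF this Suc.IH] show ?thesis
      using Suc by simp
  qed simp
  show ?case
    unfolding eq using 1 by (intro sum_in_bigo) auto
qed

text \<open>By the Leibniz formula, the error is a finite signed sum of the errors in
  \<open>prod_affine_bigo\<close>, one for each permutation.\<close>

lemma det_affine_bigo:
  fixes X Y :: "real mat"
  assumes X: "X \<in> carrier_mat n n" and Y: "Y \<in> carrier_mat n n"
  shows "(\<lambda>w. det (real w \<cdot>\<^sub>m X + Y) - real w ^ n * det X) \<in> O(\<lambda>w. real w ^ (n - 1))"
proof -
  let ?Q = "{p. p permutes {0..<n}}"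
  have p: "p i < n" if "p \<in> ?Q" "i < n" for p i
    using permutes_in_image[of p "{0..<n}" i] that by simp
  have "det (real w \<cdot>\<^sub>m X + Y) - real w ^ n * det X = (\<Sum>p\<in>?Q. signof p *
      ((\<Prod>i<n. real w * X $$ (i, p i) + Y $$ (i, p i)) - real w ^ n * (\<Prod>i<n. X $$ (i, p i))))" for w
  proof -
    have "det (real w \<cdot>\<^sub>m X + Y) = (\<Sum>p\<in>?Q. signof p * (\<Prod>i<n. real w * X $$ (i, p i) + Y $$ (i, p i)))"
      using X Y p by (subst det_def'[of _ n]) (auto simp: lessThan_atLeast0 intro!: sum.cong prod.cong)
    then show ?thesis
      unfolding det_def'[OF X]
      by (simp add: sum_subtractf right_diff_distrib sum_distrib_left lessThan_atLeast0 mult.left_commute)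
  qed
  then show ?thesis
    using prod_affine_bigo[where m = n and x = "\<lambda>i. X $$ (i, p i)" and y = "\<lambda>i. Y $$ (i, p i)" for p]
    by (simp only:) (intro big_sum_in_bigo, simp)
qed

section \<open>Matrix inverses, maximum norms and perturbation\<close>

lemma inv_mat_inverts:
  assumes M: "M \<in> carrier_mat n n" and d: "det M \<noteq> 0"
  shows "inv_mat M \<in> carrier_mat n n" "M * inv_mat M = 1\<^sub>m n" "inv_mat M * M = 1\<^sub>m n"
proof -
  obtain B where "mat_inverse M = Some B"
    using mat_inverse(1)[OF M, of "()"] det_non_zero_imp_unit[OF M d, of "()"] by (cases "mat_inverse M") auto
  with mat_inverse(2)[OF M this]
  show "inv_mat M \<in> carrier_mat n n" "M * inv_mat M = 1\<^sub>m n" "inv_mat M * M = 1\<^sub>m n"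
    by (auto simp: inv_mat_def)
qed

lemma finite_mat_entries: "finite {\<bar>M $$ (i, j)\<bar> | i j. i < dim_row M \<and> j < dim_col M}"
proof -
  have "{\<bar>M $$ (i, j)\<bar> | i j. i < dim_row M \<and> j < dim_col M} =
      (\<lambda>(i, j). \<bar>M $$ (i, j)\<bar>) ` ({..<dim_row M} \<times> {..<dim_col M})"
    by auto
  then show ?thesis by simp
qed

lemma abs_entry_le_mat_norm_inf:
  assumes "i < dim_row M" "j < dim_col M"
  shows "\<bar>M $$ (i, j)\<bar> \<le> mat_norm_inf M"
  unfolding mat_norm_inf_def using assms by (intro Max_ge finite_mat_entries) auto

text \<open>Positive dimensions keep the set of entries nonempty, without which \<open>Max\<close>
  is unspecified.\<close>

lemma mat_norm_inf_le:
  assumes "0 < dim_row M" "0 < dim_col M"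
    and "\<And>i j. i < dim_row M \<Longrightarrow> j < dim_col M \<Longrightarrow> \<bar>M $$ (i, j)\<bar> \<le> b"
  shows "mat_norm_inf M \<le> b"
  unfolding mat_norm_inf_def using assms by (intro Max.boundedI finite_mat_entries) blast+

lemma vec_norm_inf_eqI:
  assumes "k < dim_vec v" "\<And>i. i < dim_vec v \<Longrightarrow> \<bar>v $ i\<bar> \<le> \<bar>v $ k\<bar>"
  shows "vec_norm_inf v = \<bar>v $ k\<bar>"
  unfolding vec_norm_inf_def
proof (rule Max_eqI)
  have "{\<bar>v $ i\<bar> | i. i < dim_vec v} = (\<lambda>i. \<bar>v $ i\<bar>) ` {..<dim_vec v}"
    by auto
  then show "finite {\<bar>v $ i\<bar> | i. i < dim_vec v}" by simp
qed (use assms in auto)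

text \<open>The error \<open>X = A - c B\<close> of the rescaled inverse \<open>B = (c A\<^sub>0 + S)\<^sup>-\<^sup>1\<close> satisfies the
  fixed-point equation \<open>X = c\<^sup>-\<^sup>1 A S (A - X)\<close>, which bounds it once \<open>c\<close> is large.\<close>

lemma rescaled_inverse_bigo:
  fixes A A0 S :: "real mat" and B :: "nat \<Rightarrow> real mat" and c :: "nat \<Rightarrow> real"
  assumes n: "n \<ge> 1"
    and A: "A \<in> carrier_mat n n" and A0: "A0 \<in> carrier_mat n n" and S: "S \<in> carrier_mat n n"
    and B: "\<And>w. B w \<in> carrier_mat n n"
    and AA0: "A * A0 = 1\<^sub>m n" and inv: "\<And>w. (c w \<cdot>\<^sub>m A0 + S) * B w = 1\<^sub>m n"
    and c: "filterlim c at_top sequentially"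
  shows "(\<lambda>w. mat_norm_inf (A - c w \<cdot>\<^sub>m B w)) \<in> O(\<lambda>w. 1 / c w)"
proof -
  define K where "K = mat_norm_inf (A * S)"
  define L where "L = mat_norm_inf A"
  define N where "N w = mat_norm_inf (A - c w \<cdot>\<^sub>m B w)" for w
  have N0: "N w \<ge> 0" for w
    using abs_entry_le_mat_norm_inf[of 0 "A - c w \<cdot>\<^sub>m B w" 0] n A B[of w] unfolding N_def by auto
  have K0: "K \<ge> 0"
    using abs_entry_le_mat_norm_inf[of 0 "A * S" 0] n A S unfolding K_def by auto
  have L0: "L \<ge> 0"
    using abs_entry_le_mat_norm_inf[of 0 A 0] n A unfolding L_def by auto
  \<comment> \<open>Multiply \<open>inv\<close> by \<open>A\<close> from the left and use
    \<open>AA0\<close>.\<close>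
  have eq: "A - c w \<cdot>\<^sub>m B w = (A * S) * B w" for w
  proof -
    have "A = A * ((c w \<cdot>\<^sub>m A0 + S) * B w)"
      using inv A by simp
    also have "\<dots> = A * (c w \<cdot>\<^sub>m A0 + S) * B w"
      using A A0 S B by (intro assoc_mult_mat[symmetric]) auto
    also have "A * (c w \<cdot>\<^sub>m A0 + S) = A * (c w \<cdot>\<^sub>m A0) + A * S"
      using A A0 S by (intro mult_add_distrib_mat) auto
    also have "A * (c w \<cdot>\<^sub>m A0) = c w \<cdot>\<^sub>m 1\<^sub>m n"
      using mult_smult_distrib[OF A A0] AA0 by simp
    also have "(c w \<cdot>\<^sub>m 1\<^sub>m n + A * S) * B w = c w \<cdot>\<^sub>m 1\<^sub>m n * B w + A * S * B w"
      using A S B by (intro add_mult_distrib_mat) auto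
    also have "c w \<cdot>\<^sub>m 1\<^sub>m n * B w = c w \<cdot>\<^sub>m B w"
      using mult_smult_assoc_mat[of "1\<^sub>m n" n n "B w" n] B[of w] by simp
    finally have *: "A = c w \<cdot>\<^sub>m B w + A * S * B w" .
    show ?thesis
    proof (rule eq_matI)
      fix i j assume "i < dim_row (A * S * B w)" "j < dim_col (A * S * B w)"
      then have ij: "i < n" "j < n" using A B[of w] by auto
      have "A $$ (i, j) = (c w \<cdot>\<^sub>m B w + A * S * B w) $$ (i, j)"
        using * by simp
      also have "\<dots> = (c w \<cdot>\<^sub>m B w) $$ (i, j) + (A * S * B w) $$ (i, j)"
        using ij A S B[of w] by (intro index_add_mat) auto
      finally show "(A - c w \<cdot>\<^sub>m B w) $$ (i, j) = (A * S * B w) $$ (i, j)"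
        using ij A B[of w] by simp
    qed (use A B[of w] in auto)
  qed
  \<comment> \<open>The threshold makes \<open>real n * K * N w\<close> at most half of
    \<open>c w * N w\<close>; the summand \<open>1\<close> keeps \<open>c w\<close> positive even
    when \<open>K = 0\<close>.\<close>
  have bound: "N w \<le> 2 * real n * K * L * (1 / c w)" if cw: "c w \<ge> 2 * real n * K + 1" for w
  proof -
    have cpos: "c w > 0"
      using cw K0 by (smt (verit) mult_nonneg_nonneg of_nat_0_le_iff)
    have cB: "\<bar>c w * B w $$ (k, j)\<bar> \<le> L + N w" if "k < n" "j < n" for k j
    proof -
      have "\<bar>A $$ (k, j)\<bar> \<le> L"
        unfolding L_def using that A by (intro abs_entry_le_mat_norm_inf) auto
      moreover have "\<bar>(A - c w \<cdot>\<^sub>m B w) $$ (k, j)\<bar> \<le> N w"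
        unfolding N_def using that A B[of w] by (intro abs_entry_le_mat_norm_inf) auto
      moreover have "(A - c w \<cdot>\<^sub>m B w) $$ (k, j) = A $$ (k, j) - c w * B w $$ (k, j)"
        using that A B[of w] by simp
      ultimately show ?thesis by linarith
    qed
    have "N w \<le> real n * (K * (L + N w)) / c w"
      unfolding N_def
    proof (rule mat_norm_inf_le, unfold N_def[symmetric])
      fix i j assume "i < dim_row (A - c w \<cdot>\<^sub>m B w)" "j < dim_col (A - c w \<cdot>\<^sub>m B w)"
      then have ij: "i < n" "j < n" using A B[of w] by auto
      have "c w * (A - c w \<cdot>\<^sub>m B w) $$ (i, j) = (\<Sum>k<n. (A * S) $$ (i, k) * (c w * B w $$ (k, j)))"
        unfolding eq using ij A S B[of w]
        by (subst index_mult_mat)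
          (auto simp: scalar_prod_def lessThan_atLeast0 sum_distrib_left mult.left_commute intro!: sum.cong)
      also have "\<bar>\<dots>\<bar> \<le> (\<Sum>k<n. K * (L + N w))"
      proof (rule order_trans[OF sum_abs], rule sum_mono)
        fix k assume "k \<in> {..<n}"
        then show "\<bar>(A * S) $$ (i, k) * (c w * B w $$ (k, j))\<bar> \<le> K * (L + N w)"
          unfolding abs_mult[of "(A * S) $$ (i, k)"] using ij A S K0
          by (intro mult_mono cB) (auto simp: K_def intro!: abs_entry_le_mat_norm_inf simp del: index_mult_mat(1))
      qed
      finally have "c w * \<bar>(A - c w \<cdot>\<^sub>m B w) $$ (i, j)\<bar> \<le> real n * (K * (L + N w))"
        using cpos by (simp add: abs_mult)
      then show "\<bar>(A - c w \<cdot>\<^sub>m B w) $$ (i, j)\<bar> \<le> real n * (K * (L + N w)) / c w"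
        using cpos by (simp add: field_simps)
    qed (use n A B[of w] in auto)
    then have "c w * N w \<le> real n * K * L + real n * K * N w"
      using cpos by (simp add: field_simps)
    \<comment> \<open>The error occurs on both sides of the preceding estimate; this inequality
      absorbs its right-hand occurrence into the left.\<close>
    moreover have "(2 * real n * K + 1) * N w \<le> c w * N w"
      using cw N0 by (rule mult_right_mono)
    ultimately have "c w * N w \<le> 2 * real n * K * L"
      using N0[of w] by (simp add: algebra_simps)
    then show ?thesis
      using cpos by (simp add: field_simps)
  qed
  have "\<forall>\<^sub>F w in sequentially. c w \<ge> 2 * real n * K + 1"
    using c by (simp add: filterlim_at_top)
  then have "\<forall>\<^sub>F w in sequentially. norm (N w) \<le> (2 * real n * K * L) * norm (1 / c w)"
  proof eventually_elim
    case (elim w)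
    moreover have "2 * real n * K \<ge> 0" using K0 by simp
    ultimately have "c w > 0" by linarith
    then show ?case
      using bound[OF elim] N0[of w] by simp
  qed
  then show ?thesis
    unfolding N_def by (rule bigoI)
qed

section \<open>Normal vectors and Gram matrices of the family in \<open>w\<close>\<close>

text \<open>Coordinate \<open>j\<close> is a signed minor that is again affine in \<open>w\<close>,
  with leading matrix \<open>X'\<close> obtained from \<open>X\<close> with its zero column by
  deleting column \<open>j\<close>. For \<open>j = n\<close> the zero column goes and
  \<open>X\<close> remains; otherwise it survives and the leading determinant vanishes.\<close>

lemma normal_vec_affine_bigo:
  fixes X P :: "real mat"
  assumes n: "n \<ge> 1" and X: "X \<in> carrier_mat n n" and P: "P \<in> carrier_mat n (Suc n)" and j: "j \<le> n"
  shows "(\<lambda>w. normal_vec (real w \<cdot>\<^sub>m append_zero_col X + P) $ j -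
    (if j = n then det X else 0) * real w ^ n) \<in> O(\<lambda>w. real w ^ (n - 1))"
proof -
  \<comment> \<open>Enumerates the columns other than \<open>j\<close> in increasing order.\<close>
  define skip where "skip k = (if k < j then k else Suc k)" for k
  define X' where "X' = mat n n (\<lambda>(i, k). append_zero_col X $$ (i, skip k))"
  define P' where "P' = mat n n (\<lambda>(i, k). P $$ (i, skip k))"
  have carr: "X' \<in> carrier_mat n n" "P' \<in> carrier_mat n n"
    by (simp_all add: X'_def P'_def)
  have v: "normal_vec (real w \<cdot>\<^sub>m append_zero_col X + P) $ j =
      (-1) ^ (n + j) * det (real w \<cdot>\<^sub>m X' + P')" for w
  proof -
    have G: "real w \<cdot>\<^sub>m append_zero_col X + P \<in> carrier_mat n (Suc n)"
      using P by simp
    have "mat_delete (append_unit_row (real w \<cdot>\<^sub>m append_zero_col X + P)) n j = real w \<cdot>\<^sub>m X' + P'"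
      using X P by (intro eq_matI)
        (auto simp: mat_delete_def append_unit_row_def X'_def P'_def skip_def append_zero_col_def)
    then show ?thesis
      using normal_vec_nth[OF G j] by simp
  qed
  have detX': "(-1) ^ (n + j) * det X' = (if j = n then det X else 0)"
  proof (cases "j = n")
    case True
    have "X' = X"
      using X True by (intro eq_matI) (auto simp: X'_def skip_def append_zero_col_def)
    then show ?thesis using True by (simp add: power_add flip: power_mult_distrib)
  next
    case False
    \<comment> \<open>Deleting a column \<open>j < n\<close> moves the appended zero column to index
      \<open>n - 1\<close>.\<close>
    have "X' *\<^sub>v unit_vec n (n - 1) = 0\<^sub>v n"
      using n j False X by (intro eq_vecI) (auto simp: X'_def skip_def append_zero_col_def)
    moreover have "unit_vec n (n - 1) \<noteq> (0\<^sub>v n :: real vec)"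
      using n by (intro unit_vec_nonzero) auto
    ultimately have "det X' = 0"
      unfolding det_0_iff_vec_prod_zero[OF carr(1)] by (intro exI[of _ "unit_vec n (n - 1)"]) auto
    then show ?thesis using False by simp
  qed
  have "normal_vec (real w \<cdot>\<^sub>m append_zero_col X + P) $ j - (if j = n then det X else 0) * real w ^ n =
      (-1) ^ (n + j) * (det (real w \<cdot>\<^sub>m X' + P') - real w ^ n * det X')" for w
    unfolding v detX'[symmetric] by (simp add: algebra_simps)
  then show ?thesis
    using det_affine_bigo[OF carr] by simp
qed

text \<open>In the expansion of the product, the zero column contributes nothing to the quadratic
  term, and \<open>Q\<close> turns the two mixed terms into a multiple of the same Gram matrix. Only
  the constant term \<open>gram_mat P\<close> is not proportional to it.\<close>

lemma gram_mat_affine: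
  fixes X P :: "real mat"
  assumes X: "X \<in> carrier_mat n n" and P: "P \<in> carrier_mat n (Suc n)"
    and Q: "append_zero_col X * P\<^sup>T + P * (append_zero_col X)\<^sup>T = \<alpha> \<cdot>\<^sub>m gram_mat X"
  shows "gram_mat (real w \<cdot>\<^sub>m append_zero_col X + P) =
    ((real w)\<^sup>2 + \<alpha> * real w) \<cdot>\<^sub>m gram_mat X + gram_mat P"
proof (rule eq_matI)
  let ?Y = "append_zero_col X"
  have Y: "?Y \<in> carrier_mat n (Suc n)" using X by (simp add: append_zero_col_def)
  fix i j assume "i < dim_row (((real w)\<^sup>2 + \<alpha> * real w) \<cdot>\<^sub>m gram_mat X + gram_mat P)"
    "j < dim_col (((real w)\<^sup>2 + \<alpha> * real w) \<cdot>\<^sub>m gram_mat X + gram_mat P)"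
  then have ij: "i < n" "j < n" using P by (auto simp: gram_mat_def)
  have YY: "(\<Sum>k<Suc n. ?Y $$ (i, k) * ?Y $$ (j, k)) = gram_mat X $$ (i, j)"
    using ij X by (simp add: gram_mat_def append_zero_col_def scalar_prod_def lessThan_atLeast0)
  have "(?Y * P\<^sup>T + P * ?Y\<^sup>T) $$ (i, j) =
      (\<Sum>k<Suc n. ?Y $$ (i, k) * P $$ (j, k)) + (\<Sum>k<Suc n. P $$ (i, k) * ?Y $$ (j, k))"
    using ij Y P by (simp add: scalar_prod_def lessThan_atLeast0)
  moreover have "(\<alpha> \<cdot>\<^sub>m gram_mat X) $$ (i, j) = \<alpha> * gram_mat X $$ (i, j)"
    using ij X by (simp add: gram_mat_def)
  ultimately have YP: "(\<Sum>k<Suc n. ?Y $$ (i, k) * P $$ (j, k)) + (\<Sum>k<Suc n. P $$ (i, k) * ?Y $$ (j, k)) =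
      \<alpha> * gram_mat X $$ (i, j)"
    unfolding Q by simp
  have PP: "(\<Sum>k<Suc n. P $$ (i, k) * P $$ (j, k)) = gram_mat P $$ (i, j)"
    using ij P by (simp add: gram_mat_def scalar_prod_def lessThan_atLeast0)
  have "gram_mat (real w \<cdot>\<^sub>m ?Y + P) $$ (i, j) =
      (\<Sum>k<Suc n. (real w * ?Y $$ (i, k) + P $$ (i, k)) * (real w * ?Y $$ (j, k) + P $$ (j, k)))"
    using ij Y P by (simp add: gram_mat_def scalar_prod_def lessThan_atLeast0)
  also have "\<dots> = (\<Sum>k<Suc n. (real w)\<^sup>2 * (?Y $$ (i, k) * ?Y $$ (j, k)) +
      (real w * (?Y $$ (i, k) * P $$ (j, k)) + real w * (P $$ (i, k) * ?Y $$ (j, k))) +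
      P $$ (i, k) * P $$ (j, k))"
    by (intro sum.cong refl) (simp add: algebra_simps power2_eq_square)
  also have "\<dots> = (real w)\<^sup>2 * gram_mat X $$ (i, j) + real w * (\<alpha> * gram_mat X $$ (i, j)) + gram_mat P $$ (i, j)"
    unfolding sum.distrib sum_distrib_left[symmetric] YY PP YP[symmetric] by (simp only: distrib_left)
  also have "\<dots> = (((real w)\<^sup>2 + \<alpha> * real w) \<cdot>\<^sub>m gram_mat X + gram_mat P) $$ (i, j)"
    using ij X P by (simp add: gram_mat_def algebra_simps)
  finally show "gram_mat (real w \<cdot>\<^sub>m ?Y + P) $$ (i, j) =
      (((real w)\<^sup>2 + \<alpha> * real w) \<cdot>\<^sub>m gram_mat X + gram_mat P) $$ (i, j)" .
qed (use X P in \<open>auto simp: gram_mat_def\<close>)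

text \<open>The distinct independent rows are the columns of the transpose, which therefore has full
  rank.\<close>

lemma det_generator_matrix_nonzero:
  assumes "generator_matrix n n B L"
  shows "det B \<noteq> 0"
proof -
  interpret vec_space "TYPE(real)" n .
  have B: "B \<in> carrier_mat n n" "distinct (rows B)" "lin_indpt (set (rows B))"
    using assms by (auto simp: generator_matrix_def)
  then have "rank (B\<^sup>T) = n"
    by (intro lin_indpt_full_rank) auto
  then show ?thesis
    using det_rank_iff[of "B\<^sup>T"] det_transpose[OF B(1)] B(1) by simp
qed

lemma generator_matrix_Ints:
  assumes B: "generator_matrix k m B L" and L: "L \<subseteq> int_vecs m" and ij: "i < k" "j < m"
  shows "B $$ (i, j) \<in> \<int>"
proof -
  interpret vec_space "TYPE(real)" m .
  have Bc: "B \<in> carrier_mat k m" and LB: "L = lattice_of_rows B"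
    using B by (auto simp: generator_matrix_def)
  have "row B i \<in> L"
    unfolding LB lattice_of_rows_def using Bc ij
    by (auto intro!: basis_in_latticeI simp: rows_def)
  then have "row B i $ j \<in> \<int>"
    using L ij by (auto simp: int_vecs_def)
  then show ?thesis
    using Bc ij by simp
qed

text \<open>The remainder in the norm expansion is an explicit function \<open>g\<close>. The
  agreement of the two rates is expressed as an equality of O-classes, which is a two-sided
  comparison.\<close>

theorem theorem1:
  fixes n :: nat
    and \<Lambda> :: "real vec set"
    and Gbar Gstar Astar A P Q1 :: "real mat"
    and Gw Hw Awstar Aw :: "nat \<Rightarrow> real mat"
    and \<Lambda>wstar \<Lambda>w :: "nat \<Rightarrow> real vec set"
  assumes n: "n \<ge> 1"
    and lattice: "is_lattice n n \<Lambda>"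
    and dual_int: "dual_lattice n \<Lambda> \<subseteq> int_vecs n"
    and Gbar: "generator_matrix n n Gbar (dual_lattice n \<Lambda>)"
    and Astar: "Astar = gram_mat Gbar"
    and A: "A = inv_mat Astar"
    and Gstar: "Gstar = append_zero_col Gbar"
    and P: "P \<in> carrier_mat n (n + 1)" "elements_mat P \<subseteq> \<int>"
    and Gw: "\<And>w. Gw w = real w \<cdot>\<^sub>m Gstar + P"
    and \<Lambda>wstar: "\<And>w. \<Lambda>wstar w = lattice_of_rows (Gw w)"
    and Awstar: "\<And>w. Awstar w = gram_mat (Gw w)"
    and Aw: "\<And>w. Aw w = inv_mat (Awstar w)"
    and \<Lambda>w: "\<And>w. \<Lambda>w w = dual_lattice (n + 1) (\<Lambda>wstar w)"
    and Hw: "\<And>w. Hw w = drop_first_col (Gw w)"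
    and Q1: "Q1 = Gstar * P\<^sup>T + P * Gstar\<^sup>T"
    and i: "\<And>w. det (Hw w) = 1 \<or> det (Hw w) = -1"
    and ii: "\<exists>\<alpha>::real. Q1 = \<alpha> \<cdot>\<^sub>m Astar"
  shows "\<exists>v :: nat \<Rightarrow> real vec.
      (\<forall>w. v w \<in> int_vecs (n + 1) \<and>
           \<Lambda>w w = orth_proj (n + 1) (vec_module.orthogonal_complement (n + 1) {v w}) ` int_vecs (n + 1)) \<and>
      (\<exists>g \<in> O(\<lambda>w. real w ^ (n - 1)).
         \<forall>\<^sub>F w in sequentially.
           vec_norm_inf (v w) = \<bar>sqrt (det Astar) * real w ^ n + g w\<bar>) \<and>
      (\<exists>c :: nat \<Rightarrow> real.
         (\<lambda>w. mat_norm_inf (A - c w \<cdot>\<^sub>m Aw w)) \<in> O(\<lambda>w. 1 / real w ^ 2) \<and>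
         O(\<lambda>w. 1 / real w ^ 2) = O(\<lambda>w. 1 / vec_norm_inf (v w) powr (2 / real n)) \<and>
         (\<lambda>w. mat_norm_inf (A - c w \<cdot>\<^sub>m Aw w)) \<longlonglongrightarrow> 0)"
proof -

  \<comment> \<open>Integrality, unimodularity and the projection\<close>
  have Gbc: "Gbar \<in> carrier_mat n n"
    using Gbar by (simp add: generator_matrix_def)
  have P': "P \<in> carrier_mat n (Suc n)"
    using P(1) by simp
  have detG: "det Gbar \<noteq> 0"
    by (rule det_generator_matrix_nonzero[OF Gbar])
  have GZ: "Gbar $$ (i, j) \<in> \<int>" if "i < n" "j < n" for i j
    by (rule generator_matrix_Ints[OF Gbar dual_int that])
  have PZ: "P $$ (i, j) \<in> \<int>" if "i < n" "j < Suc n" for i j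
    using P' P(2) that by blast
  have Gwc: "Gw w \<in> carrier_mat n (Suc n)" for w
    using P' by (simp add: Gw)
  have GwZ: "Gw w $$ (i, j) \<in> \<int>" if "i < n" "j < Suc n" for w i j
    using that Gbc P' GZ PZ by (auto simp: Gw Gstar append_zero_col_def)
  \<comment> \<open>Assumption (i) enters here: bordering changes the determinant only by the sign
    \<open>(-1) ^ n\<close>.\<close>
  have detM: "det (append_unit_row (Gw w)) = 1 \<or> det (append_unit_row (Gw w)) = -1" for w
    using det_append_unit_row[OF Gwc[of w]] i[of w] by (cases "even n") (auto simp: Hw)
  have detM0: "det (append_unit_row (Gw w)) \<noteq> 0" for w
    using detM[of w] by auto
  define v where "v w = normal_vec (Gw w)" for w
  have vc: "v w \<in> carrier_vec (Suc n)" for w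
    unfolding v_def by (rule normal_vec_carrier[OF Gwc])
  have proj: "\<Lambda>w w = orth_proj (n + 1) (vec_module.orthogonal_complement (n + 1) {v w}) ` int_vecs (n + 1)" for w
    using dual_lattice_of_rows_eq_projection[OF Gwc GwZ detM, of w] by (simp add: \<Lambda>w \<Lambda>wstar v_def)
  have vZ: "v w \<in> int_vecs (n + 1)" for w
    using normal_vec_int[OF Gwc GwZ] by (simp add: v_def)

  \<comment> \<open>Size of the projection vector\<close>
  have detA: "sqrt (det Astar) = \<bar>det Gbar\<bar>"
    using Gbc by (simp add: Astar gram_mat_def det_mult[of _ n] det_transpose)
  define g0 where "g0 w = v w $ n - det Gbar * real w ^ n" for w
  have g0: "g0 \<in> O(\<lambda>w. real w ^ (n - 1))"
    using normal_vec_affine_bigo[OF n Gbc P', of n] by (simp add: g0_def[abs_def] v_def Gw Gstar)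
  have vj: "(\<lambda>w. v w $ j) \<in> O(\<lambda>w. real w ^ (n - 1))" if "j < n" for j
    using normal_vec_affine_bigo[OF n Gbc P', of j] that by (simp add: v_def Gw Gstar)
  have small: "(\<lambda>w. real w ^ (n - 1)) \<in> o(\<lambda>w. real w ^ n)"
    using n by real_asymp
  have vn: "(\<lambda>w. v w $ n) \<in> \<Theta>(\<lambda>w. real w ^ n)"
  proof -
    have "g0 \<in> o(\<lambda>w. det Gbar * real w ^ n)"
      using landau_o.big_small_trans[OF g0 small] detG by simp
    from landau_theta.plus_absorb2[OF this]
    have "(\<lambda>w. det Gbar * real w ^ n + g0 w) \<in> \<Theta>(\<lambda>w. det Gbar * real w ^ n)"
      using bigtheta_refl by blast
    then show ?thesis
      using detG by (simp add: g0_def)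
  qed
  have "\<forall>\<^sub>F w in sequentially. \<bar>v w $ j\<bar> \<le> \<bar>v w $ n\<bar>" if "j < n" for j
  proof -
    \<comment> \<open>Coordinate \<open>j\<close> has order at most \<open>w ^ (n - 1)\<close>,
      whereas the last has exact order \<open>w ^ n\<close> because \<open>det Gbar\<close> is
      nonzero. So the last one eventually attains the norm.\<close>
    have "(\<lambda>w. v w $ j) \<in> o(\<lambda>w. v w $ n)"
      using landau_o.big_small_trans[OF vj[OF that] small] landau_o.small.cong_bigtheta[OF vn] by simp
    from landau_o.smallD[OF this, of 1] show ?thesis by simp
  qed
  then have "\<forall>\<^sub>F w in sequentially. \<forall>j\<in>{..<n}. \<bar>v w $ j\<bar> \<le> \<bar>v w $ n\<bar>"
    by (intro eventually_ball_finite) auto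
  then have norm_v: "\<forall>\<^sub>F w in sequentially. vec_norm_inf (v w) = \<bar>v w $ n\<bar>"
  proof eventually_elim
    case (elim w)
    then show ?case
      using vc[of w] by (intro vec_norm_inf_eqI) (auto simp: less_Suc_eq)
  qed
  have size: "\<exists>g \<in> O(\<lambda>w. real w ^ (n - 1)). \<forall>\<^sub>F w in sequentially.
      vec_norm_inf (v w) = \<bar>sqrt (det Astar) * real w ^ n + g w\<bar>"
  \<comment> \<open>The root equals \<open>sgn (det Gbar) * det Gbar\<close>, so the remainder of
    the last coordinate takes the same sign; the outer absolute value does not see it.\<close>
  proof (rule bexI[of _ "\<lambda>w. sgn (det Gbar) * g0 w"])
    show "(\<lambda>w. sgn (det Gbar) * g0 w) \<in> O(\<lambda>w. real w ^ (n - 1))"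
      using g0 detG by (simp add: sgn_eq_0_iff)
    show "\<forall>\<^sub>F w in sequentially.
        vec_norm_inf (v w) = \<bar>sqrt (det Astar) * real w ^ n + sgn (det Gbar) * g0 w\<bar>"
      using norm_v
    proof eventually_elim
      case (elim w)
      have "sqrt (det Astar) * real w ^ n + sgn (det Gbar) * g0 w = sgn (det Gbar) * v w $ n"
        unfolding detA abs_sgn by (simp add: g0_def algebra_simps)
      then show ?case
        using elim detG by (simp add: abs_mult abs_sgn_eq)
    qed
  qed
  have "(\<lambda>w. vec_norm_inf (v w)) \<in> \<Theta>(\<lambda>w. real w ^ n)"
    using vn norm_v by (subst landau_theta.in_cong[OF norm_v]) simp
  \<comment> \<open>\<open>bigtheta_powr\<close> speaks of absolute values; \<open>abs_norm\<close>
    removes them below, where the norm eventually equals the absolute value of a coordinate.\<close>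
  then have "(\<lambda>w. \<bar>vec_norm_inf (v w)\<bar> powr (2 / real n)) \<in> \<Theta>(\<lambda>w. \<bar>real w ^ n\<bar> powr (2 / real n))"
    by (rule bigtheta_powr)
  also have "(\<lambda>w. \<bar>real w ^ n\<bar> powr (2 / real n)) \<in> \<Theta>(\<lambda>w. real w ^ 2)"
  proof (intro bigthetaI_cong eventually_sequentiallyI[of 1])
    fix w :: nat assume "w \<ge> 1"
    then have "\<bar>real w ^ n\<bar> powr (2 / real n) = (real w powr real n) powr (2 / real n)"
      by (simp add: powr_realpow)
    also have "\<dots> = real w powr real 2"
      unfolding powr_powr using n by simp
    also have "\<dots> = real w ^ 2"
      using \<open>w \<ge> 1\<close> by (intro powr_realpow) simp
    finally show "\<bar>real w ^ n\<bar> powr (2 / real n) = real w ^ 2" .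
  qed
  finally have theta: "(\<lambda>w. inverse (\<bar>vec_norm_inf (v w)\<bar> powr (2 / real n))) \<in> \<Theta>(\<lambda>w. inverse (real w ^ 2))"
    by simp
  have "\<forall>\<^sub>F w in sequentially. \<bar>vec_norm_inf (v w)\<bar> = vec_norm_inf (v w)"
    using norm_v by eventually_elim simp
  then have abs_norm: "\<forall>\<^sub>F w in sequentially. inverse (\<bar>vec_norm_inf (v w)\<bar> powr (2 / real n)) =
      1 / vec_norm_inf (v w) powr (2 / real n)"
    by eventually_elim (simp add: field_simps)
  have "(\<lambda>w. 1 / vec_norm_inf (v w) powr (2 / real n)) \<in> \<Theta>(\<lambda>w. 1 / real w ^ 2)"
    using iffD1[OF landau_theta.in_cong[OF abs_norm] theta] by (simp only: inverse_eq_divide)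
  then have rate: "O(\<lambda>w. 1 / real w ^ 2) = O(\<lambda>w. 1 / vec_norm_inf (v w) powr (2 / real n))"
    by (rule landau_o.big.cong_bigtheta[symmetric])

  \<comment> \<open>Convergence of the rescaled Gram matrices\<close>
  obtain \<alpha> where \<alpha>: "Q1 = \<alpha> \<cdot>\<^sub>m Astar"
    using ii by blast
  \<comment> \<open>The coefficient of \<open>Astar\<close> in \<open>Awstar w\<close>. Whatever the
    sign of \<alpha>, the quadratic term dominates, so \<open>c\<close> tends to infinity and
    \<open>1 / c w\<close> is of order \<open>1 / w ^ 2\<close>.\<close>
  define c where "c w = (real w)\<^sup>2 + \<alpha> * real w" for w
  have Asc: "Astar \<in> carrier_mat n n" and PPc: "gram_mat P \<in> carrier_mat n n"
    using Gbc P' by (auto simp: Astar gram_mat_def)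
  have gram: "Awstar w = c w \<cdot>\<^sub>m Astar + gram_mat P" for w
    using gram_mat_affine[OF Gbc P', of \<alpha> w] \<alpha> by (simp add: Awstar Gw Gstar Astar Q1 c_def)
  have Awsc: "Awstar w \<in> carrier_mat n n" and detAw: "det (Awstar w) \<noteq> 0" for w
    using det_gram_mat_nonzero[OF Gwc detM0] Gwc[of w] by (auto simp: Awstar gram_mat_def)
  have detA0: "det Astar \<noteq> 0"
    using Gbc detG by (simp add: Astar gram_mat_def det_mult[of _ n] det_transpose)
  have "(\<lambda>w. mat_norm_inf (A - c w \<cdot>\<^sub>m Aw w)) \<in> O(\<lambda>w. 1 / c w)"
  proof (rule rescaled_inverse_bigo[OF n _ Asc PPc])
    show "A \<in> carrier_mat n n" "A * Astar = 1\<^sub>m n"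
      using inv_mat_inverts[OF Asc detA0] by (simp_all add: A)
    show "Aw w \<in> carrier_mat n n" "(c w \<cdot>\<^sub>m Astar + gram_mat P) * Aw w = 1\<^sub>m n" for w
      using inv_mat_inverts[OF Awsc detAw, of w] by (simp_all add: Aw gram)
    show "filterlim c at_top sequentially"
      unfolding c_def[abs_def] by real_asymp
  qed
  also have "(\<lambda>w. 1 / c w) \<in> O(\<lambda>w. 1 / real w ^ 2)"
    unfolding c_def[abs_def] by real_asymp
  finally have conv: "(\<lambda>w. mat_norm_inf (A - c w \<cdot>\<^sub>m Aw w)) \<in> O(\<lambda>w. 1 / real w ^ 2)" .
  have "(\<lambda>w. 1 / real w ^ 2) \<in> o(\<lambda>_. 1 :: real)"
    by real_asymp
  with conv have "(\<lambda>w. mat_norm_inf (A - c w \<cdot>\<^sub>m Aw w)) \<in> o(\<lambda>_. 1 :: real)"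
    by (rule landau_o.big_small_trans)
  then have lim: "(\<lambda>w. mat_norm_inf (A - c w \<cdot>\<^sub>m Aw w)) \<longlonglongrightarrow> 0"
    by (auto dest: smalloD_tendsto)
  show ?thesis
    using vZ proj size conv rate lim by blast
qed

end
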